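(* Let $E$ be a finite set. For a subset $L\subseteq\{\pm1\}^E$ the following are equivalent: (a) $L$ is ample; (b) there exists a weakly convex subset $K$ of $\mathbb R^E$ with $L=L(K)$; (c) there exists a compact weakly convex subset $K$ of $H(E)$ with $L=L(K)$.
   Context: $E$ is a finite set; $\{\pm1\}^E$ and $\mathbb R^E$ are the sets of maps from $E$ to $\{-1,+1\}$ and $\mathbb R$; $H(E)=[-1,+1]^E\subset\mathbb R^E$. The $\ell_1$-metric on $\mathbb R^E$ is $d(r',r'')=\sum_{e\in E}|r'(e)-r''(e)|$. Ampleness: a set $A\subseteq E$ is shattered by $L\subseteq\{\pm1\}^E$ if $\{s|_A: s\in L\}=\{\pm1\}^A$. $L$ is ample if $\#L$ equals the number of subsets $A\subseteq E$ shattered by $L$. Weakly convex: $K\subseteq\mathbb R^E$ is weakly convex if $(K,d)$ is complete and for any two distinct $r',r''\in K$ there is $r\in K$, $r\ne r',r''$, with $d(r',r'')=d(r',r)+d(r,r'')$. Orthant intersection pattern: for $s\in\{\pm1\}^E$ the closed orthant is $O(s)=\{r\in\mathbb R^E: r(e)s(e)\ge0\text{ for all }e\in E\}$, and for $K\subseteq\mathbb R^E$, $L(K):=\{s\in\{\pm1\}^E: K\cap O(s)\ne\varnothing\}$. *)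

theory Defs
  imports "HOL-Analysis.Analysis"
begin

text \<open>
  The set \<open>X\<^sup>E\<close> of maps from \<open>E\<close> to \<open>X\<close> is represented by
  \<open>E \<rightarrow>\<^sub>E X\<close>, i.e. by functions that are \<open>undefined\<close> outside \<open>E\<close>, so that
  functions correspond one-to-one to maps on \<open>E\<close>, and \<open>E = {}\<close> is allowed.
  The signs are the real numbers \<open>-1\<close> and \<open>1\<close>, so sign vectors are
  particular elements of \<open>\<real>\<^sup>E\<close>.
\<close>

definition sign_vectors :: "'e set \<Rightarrow> ('e \<Rightarrow> real) set" where
  "sign_vectors E = E \<rightarrow>\<^sub>E {-1, 1}"

definition real_vectors :: "'e set \<Rightarrow> ('e \<Rightarrow> real) set" where
  "real_vectors E = E \<rightarrow>\<^sub>E UNIV"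

definition hypercube :: "'e set \<Rightarrow> ('e \<Rightarrow> real) set" where
  "hypercube E = E \<rightarrow>\<^sub>E {-1..1}"

definition l1_dist :: "'e set \<Rightarrow> ('e \<Rightarrow> real) \<Rightarrow> ('e \<Rightarrow> real) \<Rightarrow> real" where
  "l1_dist E r' r'' = (\<Sum>e\<in>E. \<bar>r' e - r'' e\<bar>)"

lemma Metric_space_l1_dist:
  assumes "finite E" and "K \<subseteq> real_vectors E"
  shows "Metric_space K (l1_dist E)"
proof
  show "0 \<le> l1_dist E x y" for x y
    by (simp add: l1_dist_def sum_nonneg)
  show "l1_dist E x y = l1_dist E y x" for x y
    by (simp add: l1_dist_def abs_minus_commute)
  show "l1_dist E x y = 0 \<longleftrightarrow> x = y" if "x \<in> K" "y \<in> K" for x y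
  proof
    assume "l1_dist E x y = 0"
    then have "\<forall>e\<in>E. x e = y e"
      using \<open>finite E\<close> by (simp add: l1_dist_def sum_nonneg_eq_0_iff)
    moreover have "x \<in> extensional E" "y \<in> extensional E"
      using that assms(2) by (auto simp: real_vectors_def PiE_def)
    ultimately show "x = y"
      by (auto intro: extensionalityI)
  qed (simp add: l1_dist_def)
  show "l1_dist E x z \<le> l1_dist E x y + l1_dist E y z" for x y z
    unfolding l1_dist_def sum.distrib[symmetric] by (rule sum_mono) linarith
qed

definition shattered :: "('e \<Rightarrow> real) set \<Rightarrow> 'e set \<Rightarrow> bool" where
  "shattered L A \<longleftrightarrow> (\<lambda>s. restrict s A) ` L = sign_vectors A"

definition ample :: "'e set \<Rightarrow> ('e \<Rightarrow> real) set \<Rightarrow> bool" where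
  "ample E L \<longleftrightarrow> card L = card {A. A \<subseteq> E \<and> shattered L A}"

definition weakly_convex :: "'e set \<Rightarrow> ('e \<Rightarrow> real) set \<Rightarrow> bool" where
  "weakly_convex E K \<longleftrightarrow>
     K \<subseteq> real_vectors E \<and>
     Metric_space.mcomplete K (l1_dist E) \<and>
     (\<forall>r'\<in>K. \<forall>r''\<in>K. r' \<noteq> r'' \<longrightarrow>
        (\<exists>r\<in>K. r \<noteq> r' \<and> r \<noteq> r'' \<and> l1_dist E r' r'' = l1_dist E r' r + l1_dist E r r''))"

definition orthant :: "'e set \<Rightarrow> ('e \<Rightarrow> real) \<Rightarrow> ('e \<Rightarrow> real) set" where
  "orthant E s = {r \<in> real_vectors E. \<forall>e\<in>E. r e * s e \<ge> 0}"

definition orthant_pattern :: "'e set \<Rightarrow> ('e \<Rightarrow> real) set \<Rightarrow> ('e \<Rightarrow> real) set" where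
  "orthant_pattern E K = {s \<in> sign_vectors E. K \<inter> orthant E s \<noteq> {}}"

text \<open>Compactness refers to the metric topology of \<open>\<real>\<^sup>E\<close> under \<^const>\<open>l1_dist\<close>.\<close>

definition l1_compact :: "'e set \<Rightarrow> ('e \<Rightarrow> real) set \<Rightarrow> bool" where
  "l1_compact E K \<longleftrightarrow> compactin (Metric_space.mtopology (real_vectors E) (l1_dist E)) K"

end

theory Submission
  imports Defs
begin

text \<open>
  Identify sign vectors with subsets of \<open>E\<close>. A family \<open>F\<close> strongly shatters \<open>A\<close> if it contains a
  cube with direction set \<open>A\<close>. Splitting \<open>F\<close> along a coordinate shows that \<open>F\<close> has at least as
  many members as strongly shattered sets and at most as many as shattered sets; hence \<open>F\<close> is
  ample as soon as every shattered set is strongly shattered.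

  If \<open>K\<close> is weakly convex, then two points of \<open>K\<close> on different sides of a coordinate hyperplane
  have a point of \<open>K\<close> on the hyperplane between them. Applied once for each coordinate of a set
  \<open>A\<close> shattered by the orthant pattern, this yields a point of \<open>K\<close> vanishing on \<open>A\<close>, so \<open>A\<close> is
  strongly shattered.

  Conversely, if \<open>F\<close> is ample, take for \<open>K\<close> the cubical complex spanned by \<open>F\<close>. Two points of
  \<open>K\<close> agreeing in all their non-integral coordinates \<open>X\<close> are vertices of the family of \<open>X\<close>-cubes in
  \<open>F\<close>. That family is again ample, so one of the vertices can be moved along an edge towards the
  other, and the midpoint of this edge lies between them.
\<close>

subsection \<open>Shattering in families of sets\<close>

text \<open>The reverse inclusion is automatic, so this is the usual equality of the traces on
  \<open>A\<close> with the power set.\<close>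

definition shattered_sets :: "'a set set \<Rightarrow> 'a set set" where
  "shattered_sets F = {A. Pow A \<subseteq> (\<inter>) A ` F}"

text \<open>A member is the bottom vertex of a cube with direction set \<open>X\<close> inside
  \<open>F\<close>. Disjointness from \<open>X\<close> gives each cube a single
  representative.\<close>

definition cofibre :: "'a set set \<Rightarrow> 'a set \<Rightarrow> 'a set set" where
  "cofibre F X = {S. S \<inter> X = {} \<and> (\<forall>C\<subseteq>X. S \<union> C \<in> F)}"

definition strongly_shattered_sets :: "'a set set \<Rightarrow> 'a set set" where
  "strongly_shattered_sets F = {A. cofibre F A \<noteq> {}}"

lemma shattered_sets_subset:
  assumes "F \<subseteq> Pow E"
  shows "shattered_sets F \<subseteq> Pow E"
proof
  fix A assume "A \<in> shattered_sets F"
  then obtain S where "S \<in> F" "A \<inter> S = A"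
    unfolding shattered_sets_def by auto
  then show "A \<in> Pow E" using assms by auto
qed

lemma shattered_setsE:
  assumes "A \<in> shattered_sets F" "C \<subseteq> A"
  obtains S where "S \<in> F" "A \<inter> S = C"
proof -
  have "C \<in> (\<inter>) A ` F" using assms unfolding shattered_sets_def by auto
  then show thesis using that by auto
qed

lemma cofibre_subset: "cofibre F X \<subseteq> F"
  unfolding cofibre_def by fastforce

lemma cofibre_empty [simp]: "cofibre F {} = F"
  unfolding cofibre_def by auto

lemma cofibre_singleton: "cofibre F {e} = {S \<in> F. e \<notin> S \<and> insert e S \<in> F}"
  unfolding cofibre_def by (auto simp: subset_singleton_iff)

text \<open>A cube in directions \<open>X \<union> Y\<close> is a \<open>Y\<close>-cube made of
  bottom vertices of \<open>X\<close>-cubes, so directions can be treated one at a time.\<close>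

lemma cofibre_cofibre:
  assumes "X \<inter> Y = {}"
  shows "cofibre (cofibre F X) Y = cofibre F (X \<union> Y)"
proof (intro equalityI subsetI)
  fix S assume S: "S \<in> cofibre (cofibre F X) Y"
  have "S \<union> C \<in> F" if C: "C \<subseteq> X \<union> Y" for C
  proof -
    have "(S \<union> C \<inter> Y) \<union> C \<inter> X \<in> F" using S unfolding cofibre_def by simp
    moreover have "(S \<union> C \<inter> Y) \<union> C \<inter> X = S \<union> C" using C by auto
    ultimately show ?thesis by simp
  qed
  moreover have "S \<inter> Y = {}" "S \<in> cofibre F X"
    using S cofibre_subset[of "cofibre F X" Y] by (auto simp: cofibre_def[of "cofibre F X"])
  then have "S \<inter> (X \<union> Y) = {}" by (auto simp: cofibre_def)
  ultimately show "S \<in> cofibre F (X \<union> Y)" unfolding cofibre_def by simp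
next
  fix S assume S: "S \<in> cofibre F (X \<union> Y)"
  have "S \<union> D \<in> cofibre F X" if D: "D \<subseteq> Y" for D
  proof -
    have "S \<union> D \<union> C \<in> F" if "C \<subseteq> X" for C
    proof -
      have "S \<union> (D \<union> C) \<in> F" using S D that unfolding cofibre_def by blast
      then show ?thesis by (simp add: Un_assoc)
    qed
    moreover have "(S \<union> D) \<inter> X = {}" using S D assms unfolding cofibre_def by auto
    ultimately show ?thesis unfolding cofibre_def by simp
  qed
  moreover have "S \<inter> Y = {}" using S unfolding cofibre_def by auto
  ultimately show "S \<in> cofibre (cofibre F X) Y"
    unfolding cofibre_def[of "cofibre F X"] by simp
qed

lemma cofibre_mono: "F \<subseteq> G \<Longrightarrow> cofibre F X \<subseteq> cofibre G X"
  unfolding cofibre_def by auto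

lemma strongly_shattered_sets_mono:
  "F \<subseteq> G \<Longrightarrow> strongly_shattered_sets F \<subseteq> strongly_shattered_sets G"
  unfolding strongly_shattered_sets_def using cofibre_mono by blast

lemma strongly_shattered_subset:
  assumes "F \<subseteq> Pow E"
  shows "strongly_shattered_sets F \<subseteq> Pow E"
proof
  fix A assume "A \<in> strongly_shattered_sets F"
  then obtain S where "S \<union> A \<in> F"
    unfolding strongly_shattered_sets_def cofibre_def by auto
  then show "A \<in> Pow E" using assms by auto
qed

section \<open>Counting by splitting along a coordinate\<close>

text \<open>Two distinct members differ at some \<open>e\<close>, and then both halves at
  \<open>e\<close> are proper subfamilies, so induction on the cardinality applies.\<close>

lemma split_induct [consumes 1, case_names empty singleton split]:
  assumes "finite F"
    and "P {}"
    and "\<And>S. P {S}"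
    and "\<And>F e. finite F \<Longrightarrow> P {S \<in> F. e \<in> S} \<Longrightarrow> P {S \<in> F. e \<notin> S} \<Longrightarrow> P F"
  shows "P F"
  using assms(1)
proof (induction "card F" arbitrary: F rule: less_induct)
  case less
  show ?case
  proof (cases "\<exists>S\<in>F. \<exists>T\<in>F. S \<noteq> T")
    case True
    then obtain S T e where "S \<in> F" "T \<in> F" "e \<in> S" "e \<notin> T" by blast
    then have "{S \<in> F. e \<in> S} \<subset> F" "{S \<in> F. e \<notin> S} \<subset> F" by auto
    then show ?thesis
      using less assms(4)[of F e] by (metis psubset_card_mono finite_subset psubset_imp_subset)
  next
    case False
    then have "F = {} \<or> (\<exists>S. F = {S})" by blast
    then show ?thesis using assms(2,3) by auto
  qed
qed

lemma card_split:
  assumes "finite F"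
  shows "card F = card {S \<in> F. e \<in> S} + card {S \<in> F. e \<notin> S}"
proof -
  have "F = {S \<in> F. e \<in> S} \<union> {S \<in> F. e \<notin> S}" by auto
  then show ?thesis using assms card_Un_disjoint[of "{S \<in> F. e \<in> S}" "{S \<in> F. e \<notin> S}"] by force
qed

lemma finite_insert_mem:
  assumes "finite F"
  shows "finite {A. e \<notin> A \<and> insert e A \<in> F}"
proof (rule finite_subset)
  show "{A. e \<notin> A \<and> insert e A \<in> F} \<subseteq> (\<lambda>A. A - {e}) ` F"
    by (auto intro: rev_image_eqI[of "insert e A" for A])
  show "finite ((\<lambda>A. A - {e}) ` F)" using assms by simp
qed

text \<open>Sets containing \<open>e\<close> are counted after deleting \<open>e\<close>, so that
  both classes on the left consist of sets avoiding \<open>e\<close> and can be compared with sets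
  shattered by halves.\<close>

lemma card_family_split:
  assumes "finite F"
  shows "card {A \<in> F. e \<notin> A} + card {A. e \<notin> A \<and> insert e A \<in> F} = card F"
proof -
  have "bij_betw (insert e) {A. e \<notin> A \<and> insert e A \<in> F} {A \<in> F. e \<in> A}"
    by (rule bij_betw_byWitness[where f' = "\<lambda>A. A - {e}"]) (auto simp: insert_absorb)
  then show ?thesis using card_split[OF assms, of e] by (simp add: bij_betw_same_card)
qed

text \<open>A set shattered by one half avoids \<open>e\<close>, because membership of
  \<open>e\<close> is constant on the half. A set shattered by both halves stays shattered by
  \<open>F\<close> after \<open>e\<close> is added. Counting union and intersection gives
  superadditivity.\<close>

lemma card_shattered_sets_split:
  assumes "finite E" "F \<subseteq> Pow E"
  shows "card (shattered_sets {S \<in> F. e \<in> S}) + card (shattered_sets {S \<in> F. e \<notin> S})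
           \<le> card (shattered_sets F)"
proof -
  let ?P = "shattered_sets {S \<in> F. e \<in> S}" and ?M = "shattered_sets {S \<in> F. e \<notin> S}"
  let ?Q = "{A. e \<notin> A \<and> insert e A \<in> shattered_sets F}"
  have fin: "finite (shattered_sets F)"
    using shattered_sets_subset[OF assms(2)] assms(1) by (meson finite_Pow_iff finite_subset)
  have finPM: "finite ?P" "finite ?M"
    using assms by (auto intro!: finite_subset[OF shattered_sets_subset[of _ E]])
  have 1: "?P \<union> ?M \<subseteq> {A \<in> shattered_sets F. e \<notin> A}"
  proof
    fix A assume A: "A \<in> ?P \<union> ?M"
    then have "A \<in> shattered_sets F" unfolding shattered_sets_def by auto
    moreover have "e \<notin> A"
    proof
      assume "e \<in> A"
      then have "{} \<in> Pow A" "{e} \<in> Pow A" by auto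
      then show False using A \<open>e \<in> A\<close> unfolding shattered_sets_def by blast
    qed
    ultimately show "A \<in> {A \<in> shattered_sets F. e \<notin> A}" by simp
  qed
  have 2: "?P \<inter> ?M \<subseteq> ?Q"
  proof
    fix A assume A: "A \<in> ?P \<inter> ?M"
    then have AP: "A \<in> ?P" and AM: "A \<in> ?M" by simp_all
    have e: "e \<notin> A" using 1 A by auto
    have "C \<in> (\<inter>) (insert e A) ` F" if C: "C \<in> Pow (insert e A)" for C
    proof -
      have C': "C - {e} \<subseteq> A" using C by auto
      obtain S where "S \<in> {S \<in> F. e \<in> S}" "A \<inter> S = C - {e}"
        by (rule shattered_setsE[OF AP C'])
      moreover obtain T where "T \<in> {S \<in> F. e \<notin> S}" "A \<inter> T = C - {e}"
        by (rule shattered_setsE[OF AM C'])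
      \<comment> \<open>The half from which the witness is taken decides whether \<open>e\<close>
        belongs to the trace.\<close>
      ultimately have "C = insert e A \<inter> (if e \<in> C then S else T)"
        and "(if e \<in> C then S else T) \<in> F"
        using e by auto
      then show ?thesis by (rule image_eqI)
    qed
    then have "Pow (insert e A) \<subseteq> (\<inter>) (insert e A) ` F" by (rule subsetI)
    then have "insert e A \<in> shattered_sets F" unfolding shattered_sets_def by simp
    then show "A \<in> ?Q" using e by auto
  qed
  have finQ: "finite ?Q" using fin by (rule finite_insert_mem)
  have "card ?P + card ?M = card (?P \<union> ?M) + card (?P \<inter> ?M)"
    using finPM by (rule card_Un_Int)
  also have "\<dots> \<le> card {A \<in> shattered_sets F. e \<notin> A} + card ?Q"
    using 1 2 fin finQ by (intro add_mono card_mono) auto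
  also have "\<dots> = card (shattered_sets F)"
    using fin by (rule card_family_split)
  finally show ?thesis .
qed

text \<open>Dually, a cube without direction \<open>e\<close> lies inside one half, and a cube with
  direction \<open>e\<close> has a facet in each half; the count is subadditive.\<close>

lemma card_strongly_shattered_sets_split:
  assumes "finite E" "F \<subseteq> Pow E"
  shows "card (strongly_shattered_sets F) \<le>
           card (strongly_shattered_sets {S \<in> F. e \<in> S}) +
           card (strongly_shattered_sets {S \<in> F. e \<notin> S})"
proof -
  let ?P = "strongly_shattered_sets {S \<in> F. e \<in> S}"
  let ?M = "strongly_shattered_sets {S \<in> F. e \<notin> S}"
  have fin: "finite (strongly_shattered_sets F)"
    using strongly_shattered_subset[OF assms(2)] assms(1) by (meson finite_Pow_iff finite_subset)
  have finPM: "finite ?P" "finite ?M"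
    using strongly_shattered_sets_mono[of "{S \<in> F. e \<in> S}" F]
      strongly_shattered_sets_mono[of "{S \<in> F. e \<notin> S}" F] fin
    by (auto intro: finite_subset)
  have 1: "{A \<in> strongly_shattered_sets F. e \<notin> A} \<subseteq> ?P \<union> ?M"
  proof
    fix A assume "A \<in> {A \<in> strongly_shattered_sets F. e \<notin> A}"
    then obtain S where "e \<notin> A" "S \<in> cofibre F A"
      unfolding strongly_shattered_sets_def by auto
    then have "S \<in> cofibre {S \<in> F. e \<in> S} A \<or> S \<in> cofibre {S \<in> F. e \<notin> S} A"
      unfolding cofibre_def by (cases "e \<in> S") auto
    then show "A \<in> ?P \<union> ?M" unfolding strongly_shattered_sets_def by auto
  qed
  have 2: "{A. e \<notin> A \<and> insert e A \<in> strongly_shattered_sets F} \<subseteq> ?P \<inter> ?M"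
  proof
    fix A assume "A \<in> {A. e \<notin> A \<and> insert e A \<in> strongly_shattered_sets F}"
    then obtain S where e: "e \<notin> A" and S: "S \<inter> insert e A = {}"
      "\<And>C. C \<subseteq> insert e A \<Longrightarrow> S \<union> C \<in> F"
      unfolding strongly_shattered_sets_def cofibre_def by auto
    have "insert e S \<union> C \<in> F" if "C \<subseteq> A" for C
      using S(2)[of "insert e C"] that by auto
    then have "insert e S \<in> cofibre {S \<in> F. e \<in> S} A"
      using S(1) e unfolding cofibre_def by auto
    moreover have "S \<in> cofibre {S \<in> F. e \<notin> S} A"
      using S e unfolding cofibre_def by auto
    ultimately show "A \<in> ?P \<inter> ?M" unfolding strongly_shattered_sets_def by blast
  qed
  have "card (strongly_shattered_sets F) = card {A \<in> strongly_shattered_sets F. e \<notin> A}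
      + card {A. e \<notin> A \<and> insert e A \<in> strongly_shattered_sets F}"
    using card_family_split[OF fin] by simp
  also have "\<dots> \<le> card (?P \<union> ?M) + card (?P \<inter> ?M)"
    using 1 2 finPM by (intro add_mono card_mono) auto
  also have "\<dots> = card ?P + card ?M"
    using card_Un_Int[OF finPM] by simp
  finally show ?thesis .
qed

text \<open>Pajor's inequality: cardinality is additive under splitting and the shattered count
  superadditive, while a singleton shatters the empty set.\<close>

lemma card_le_card_shattered_sets:
  assumes "finite E" "F \<subseteq> Pow E"
  shows "card F \<le> card (shattered_sets F)"
proof -
  have "finite F" using assms by (meson finite_Pow_iff finite_subset)
  then show ?thesis using assms(2)
  proof (induction rule: split_induct)
    case (singleton S)
    have "finite (shattered_sets {S})"
      using shattered_sets_subset[OF singleton] assms(1) by (meson finite_Pow_iff finite_subset)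
    moreover have "{} \<in> shattered_sets {S}" unfolding shattered_sets_def by auto
    ultimately show ?case by (auto simp: Suc_le_eq card_gt_0_iff)
  next
    case (split F e)
    then have "card {S \<in> F. e \<in> S} \<le> card (shattered_sets {S \<in> F. e \<in> S})"
      "card {S \<in> F. e \<notin> S} \<le> card (shattered_sets {S \<in> F. e \<notin> S})"
      by auto
    then show ?case
      using card_split[OF split(1), of e] card_shattered_sets_split[OF assms(1) split(4), of e]
      by linarith
  qed simp
qed

text \<open>The lower half of the sandwich, by the same induction with subadditivity in place of
  superadditivity.\<close>

lemma card_strongly_shattered_sets_le_card:
  fixes E :: "'a set"
  assumes "finite E" "F \<subseteq> Pow E"
  shows "card (strongly_shattered_sets F) \<le> card F"
proof -
  have "finite F" using assms by (meson finite_Pow_iff finite_subset)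
  then show ?thesis using assms(2)
  proof (induction rule: split_induct)
    case empty
    have "strongly_shattered_sets ({} :: 'a set set) = {}"
      unfolding strongly_shattered_sets_def cofibre_def by auto
    then show ?case by simp
  next
    case (singleton S)
    have "A = {}" if A: "A \<in> strongly_shattered_sets {S}" for A
    proof -
      obtain T where T: "T \<inter> A = {}" "\<And>C. C \<subseteq> A \<Longrightarrow> T \<union> C = S"
        using A unfolding strongly_shattered_sets_def cofibre_def by auto
      \<comment> \<open>The whole cube collapses to \<open>S\<close>, so
        \<open>T = T \<union> A\<close> although \<open>T\<close> and \<open>A\<close> are
        disjoint.\<close>
      show ?thesis using T(1) T(2)[of "{}"] T(2)[of A] by auto
    qed
    then have "card (strongly_shattered_sets {S}) \<le> card {{} :: 'a set}"
      by (intro card_mono) auto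
    then show ?case by simp
  next
    case (split F e)
    then have "card (strongly_shattered_sets {S \<in> F. e \<in> S}) \<le> card {S \<in> F. e \<in> S}"
      "card (strongly_shattered_sets {S \<in> F. e \<notin> S}) \<le> card {S \<in> F. e \<notin> S}"
      by auto
    then show ?case
      using card_split[OF split(1), of e]
        card_strongly_shattered_sets_split[OF assms(1) split(4), of e]
      by linarith
  qed
qed

section \<open>Fibres and neighbours\<close>

text \<open>Each half obeys the lower bound, and subadditivity leaves neither any slack when the
  whole attains it. The coordinates of \<open>X\<close> are fixed one by one to their values in
  \<open>T\<close>.\<close>

lemma card_strongly_shattered_sets_fibre:
  assumes E: "finite E" and F: "F \<subseteq> Pow E"
    and eq: "card (strongly_shattered_sets F) = card F" and "finite X"
  shows "card (strongly_shattered_sets {S \<in> F. S \<inter> X = T \<inter> X}) = card {S \<in> F. S \<inter> X = T \<inter> X}"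
  using \<open>finite X\<close>
proof induction
  case empty
  then show ?case using eq by simp
next
  case (insert e X)
  define G where "G = {S \<in> F. S \<inter> X = T \<inter> X}"
  have G: "G \<subseteq> Pow E" and "finite G"
    using F E unfolding G_def by (auto intro: finite_subset[of _ "Pow E"])
  have sub: "{S \<in> G. e \<in> S} \<subseteq> Pow E" "{S \<in> G. e \<notin> S} \<subseteq> Pow E" using G by auto
  have "card (strongly_shattered_sets {S \<in> G. e \<in> S}) = card {S \<in> G. e \<in> S}"
    "card (strongly_shattered_sets {S \<in> G. e \<notin> S}) = card {S \<in> G. e \<notin> S}"
    using insert.IH card_split[OF \<open>finite G\<close>, of e]
      card_strongly_shattered_sets_split[OF E G, of e]
      card_strongly_shattered_sets_le_card[OF E sub(1)]
      card_strongly_shattered_sets_le_card[OF E sub(2)]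
    unfolding G_def[symmetric] by linarith+
  moreover have "{S \<in> F. S \<inter> insert e X = T \<inter> insert e X} =
      (if e \<in> T then {S \<in> G. e \<in> S} else {S \<in> G. e \<notin> S})"
    using insert.hyps unfolding G_def by auto
  ultimately show ?case by presburger
qed

text \<open>If no neighbour of \<open>S\<close> inside the cube spanned by \<open>S\<close> and \<open>T\<close> belonged to \<open>F\<close>, then deleting
  \<open>S\<close> from the fibre of \<open>F\<close> over this cube would not change the strongly shattered sets.\<close>

lemma flip_towards:
  assumes E: "finite E" and F: "F \<subseteq> Pow E"
    and eq: "card (strongly_shattered_sets F) = card F"
    and ST: "S \<in> F" "T \<in> F" "S \<noteq> T"
  shows "\<exists>e \<in> sym_diff S T. sym_diff S {e} \<in> F"
proof (rule ccontr)
  assume no: "\<not> ?thesis"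
  \<comment> \<open>\<open>X\<close> collects the coordinates where \<open>S\<close> and
    \<open>T\<close> agree, so \<open>G\<close> is the part of \<open>F\<close> inside the cube they
    span.\<close>
  define X where "X = E - sym_diff S T"
  define G where "G = {U \<in> F. U \<inter> X = S \<inter> X}"
  have SG: "S \<in> G" "T \<in> G" using ST unfolding G_def X_def by auto
  have G: "G \<subseteq> Pow E" "G - {S} \<subseteq> Pow E" "finite G"
    using F E unfolding G_def by (auto intro: finite_subset[of _ "Pow E"])
  have "A \<in> strongly_shattered_sets (G - {S})" if A: "A \<in> strongly_shattered_sets G" for A
  proof (cases "A = {}")
    case True
    then show ?thesis using SG ST(3) by (auto simp: strongly_shattered_sets_def)
  next
    case False
    then obtain a where a: "a \<in> A" by auto
    obtain B where B: "B \<inter> A = {}" "\<And>C. C \<subseteq> A \<Longrightarrow> B \<union> C \<in> G"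
      using A unfolding strongly_shattered_sets_def cofibre_def by auto
    have "B \<union> C \<noteq> S" if C: "C \<subseteq> A" for C
    proof
      assume S: "B \<union> C = S"
      have "sym_diff S {a} = B \<union> sym_diff C {a}" using S B(1) a by auto
      moreover have "sym_diff C {a} \<subseteq> A" using C a by auto
      ultimately have *: "sym_diff S {a} \<in> G" using B(2) by metis
      \<comment> \<open>All members of \<open>G\<close> agree with \<open>S\<close> on
        \<open>X\<close>, so a flip of \<open>S\<close> that stays in \<open>G\<close> happens where
        \<open>S\<close> and \<open>T\<close> differ.\<close>
      have "a \<in> E" using B(2)[of A] a G(1) by auto
      then have "a \<in> sym_diff S T" using * unfolding G_def X_def by blast
      then show False using no * unfolding G_def by auto
    qed
    then have "B \<in> cofibre (G - {S}) A" using B unfolding cofibre_def by auto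
    then show ?thesis unfolding strongly_shattered_sets_def by auto
  qed
  \<comment> \<open>Losing a member but no strongly shattered set contradicts the equality inherited
    by the fibre.\<close>
  then have "card (strongly_shattered_sets G) \<le> card (strongly_shattered_sets (G - {S}))"
    using strongly_shattered_subset[OF G(2)] E by (intro card_mono) (auto intro: finite_subset)
  also have "\<dots> \<le> card (G - {S})"
    by (rule card_strongly_shattered_sets_le_card[OF E G(2)])
  also have "\<dots> < card G" using SG G(3) by (meson card_Diff1_less)
  finally show False
    using card_strongly_shattered_sets_fibre[OF E F eq, of X S] E unfolding G_def X_def by simp
qed

section \<open>Cofibres of ample families\<close>

text \<open>Deleting \<open>e\<close> projects \<open>F\<close> onto \<open>U\<close>, with two
  preimages exactly over the cofibre, so the two cardinalities add up to \<open>card F\<close>. Sets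
  shattered by \<open>U\<close> are shattered by \<open>F\<close> and avoid \<open>e\<close>; those
  shattered by the cofibre stay shattered by \<open>F\<close> when \<open>e\<close> is added.
  Pajor's inequality holds for both families, so equality for \<open>F\<close> forces equality
  everywhere.\<close>

lemma ample_cofibre_singleton:
  assumes E: "finite E" and F: "F \<subseteq> Pow E"
    and eq: "card F = card (shattered_sets F)"
  shows "card (cofibre F {e}) = card (shattered_sets (cofibre F {e}))"
    and "\<And>A. e \<notin> A \<Longrightarrow> insert e A \<in> shattered_sets F \<Longrightarrow> A \<in> shattered_sets (cofibre F {e})"
proof -
  define U where "U = (\<lambda>S. S - {e}) ` F"
  define Q where "Q = {A. e \<notin> A \<and> insert e A \<in> shattered_sets F}"
  have finF: "finite F" using E F by (auto intro: finite_subset)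
  have U: "U \<subseteq> Pow E" and V: "cofibre F {e} \<subseteq> Pow E"
    using F cofibre_subset[of F "{e}"] unfolding U_def by auto
  have fin: "finite (shattered_sets F)"
    using shattered_sets_subset[OF F] E by (auto intro: finite_subset)
  have finQ: "finite Q" unfolding Q_def using fin by (rule finite_insert_mem)
  have Ueq: "U = {S \<in> F. e \<notin> S} \<union> {S. e \<notin> S \<and> insert e S \<in> F}"
    (is "_ = ?M \<union> ?P")
  proof (intro equalityI subsetI)
    fix S assume "S \<in> U"
    then obtain T where "T \<in> F" "S = T - {e}" unfolding U_def by auto
    then show "S \<in> ?M \<union> ?P" by (cases "e \<in> T") (auto simp: insert_absorb)
  next
    fix S assume "S \<in> ?M \<union> ?P"
    then show "S \<in> U"
      unfolding U_def by (auto intro: rev_image_eqI[of S] rev_image_eqI[of "insert e S"])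
  qed
  have finI: "finite {S. e \<notin> S \<and> insert e S \<in> F}"
    using finF by (rule finite_insert_mem)
  have "card F = card {S \<in> F. e \<notin> S} + card {S. e \<notin> S \<and> insert e S \<in> F}"
    using card_family_split[OF finF] by simp
  also have "\<dots> = card U + card ({S \<in> F. e \<notin> S} \<inter> {S. e \<notin> S \<and> insert e S \<in> F})"
    unfolding Ueq using finF finI by (intro card_Un_Int) auto
  also have "{S \<in> F. e \<notin> S} \<inter> {S. e \<notin> S \<and> insert e S \<in> F} = cofibre F {e}"
    unfolding cofibre_singleton by auto
  finally have 1: "card F = card U + card (cofibre F {e})" .
  have "shattered_sets U \<subseteq> {A \<in> shattered_sets F. e \<notin> A}"
  proof
    fix A assume A: "A \<in> shattered_sets U"
    have "e \<notin> A"
    proof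
      assume "e \<in> A"
      then obtain S where "S \<in> U" "A = A \<inter> S" using A unfolding shattered_sets_def by auto
      then show False using \<open>e \<in> A\<close> unfolding U_def by auto
    qed
    then have "A \<inter> (S - {e}) = A \<inter> S" for S by auto
    then have "(\<inter>) A ` U = (\<inter>) A ` F" unfolding U_def by (simp add: image_image)
    then show "A \<in> {A \<in> shattered_sets F. e \<notin> A}"
      using A \<open>e \<notin> A\<close> unfolding shattered_sets_def by auto
  qed
  then have 2: "card (shattered_sets U) \<le> card {A \<in> shattered_sets F. e \<notin> A}"
    using fin by (intro card_mono) auto
  have sub: "shattered_sets (cofibre F {e}) \<subseteq> Q"
  proof
    fix A assume A: "A \<in> shattered_sets (cofibre F {e})"
    have e: "e \<notin> A"
    proof
      assume "e \<in> A"
      then obtain S where "S \<in> cofibre F {e}" "A = A \<inter> S" using A unfolding shattered_sets_def by auto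
      then show False using \<open>e \<in> A\<close> unfolding cofibre_singleton by auto
    qed
    have "C \<in> (\<inter>) (insert e A) ` F" if C: "C \<in> Pow (insert e A)" for C
    proof -
      have C': "C - {e} \<subseteq> A" using C by auto
      obtain S where "S \<in> cofibre F {e}" "A \<inter> S = C - {e}"
        by (rule shattered_setsE[OF A C'])
      \<comment> \<open>Both \<open>S\<close> and \<open>insert e S\<close> lie in \<open>F\<close>,
        so the value at \<open>e\<close> can be chosen freely.\<close>
      then have "C = insert e A \<inter> (if e \<in> C then insert e S else S)"
        and "(if e \<in> C then insert e S else S) \<in> F"
        using e unfolding cofibre_singleton by auto
      then show ?thesis by (rule image_eqI)
    qed
    then have "Pow (insert e A) \<subseteq> (\<inter>) (insert e A) ` F" by (rule subsetI)
    then show "A \<in> Q" using e unfolding Q_def shattered_sets_def by simp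
  qed
  then have 3: "card (shattered_sets (cofibre F {e})) \<le> card Q"
    using finQ by (intro card_mono) auto
  have 4: "card (shattered_sets F) = card {A \<in> shattered_sets F. e \<notin> A} + card Q"
    using card_family_split[OF fin] unfolding Q_def by simp
  note 5 = card_le_card_shattered_sets[OF E U] card_le_card_shattered_sets[OF E V]
  show "card (cofibre F {e}) = card (shattered_sets (cofibre F {e}))"
    using 1 2 3 4 5 eq by linarith
  have "card (shattered_sets (cofibre F {e})) = card Q"
    using 1 2 3 4 5 eq by linarith
  then have "shattered_sets (cofibre F {e}) = Q"
    using sub finQ by (meson card_subset_eq)
  then show "A \<in> shattered_sets (cofibre F {e})"
    if "e \<notin> A" "insert e A \<in> shattered_sets F" for A
    using that unfolding Q_def by auto
qed

text \<open>Directions are added one at a time, and every intermediate cofibre is ample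
  again.\<close>

lemma ample_cofibre:
  assumes E: "finite E" and F: "F \<subseteq> Pow E"
    and eq: "card F = card (shattered_sets F)" and "finite X"
  shows "card (cofibre F X) = card (shattered_sets (cofibre F X))"
  using \<open>finite X\<close>
proof induction
  case empty
  then show ?case using eq by simp
next
  case (insert e X)
  have "cofibre F X \<subseteq> Pow E" using cofibre_subset[of F X] F by simp
  from ample_cofibre_singleton(1)[OF E this insert.IH, of e]
  show ?case using insert.hyps(2) by (simp add: cofibre_cofibre)
qed

text \<open>Passing to the cofibre at \<open>e\<close> trades a shattered \<open>insert e A\<close>
  for a shattered \<open>A\<close> and keeps ampleness; a cube found there thickens by direction
  \<open>e\<close>.\<close>

lemma ample_shattered_imp_strongly_shattered:
  assumes "finite E" "finite A"
    and "F \<subseteq> Pow E" "card F = card (shattered_sets F)" "A \<in> shattered_sets F"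
  shows "A \<in> strongly_shattered_sets F"
  using assms(2-)
proof (induction A arbitrary: F)
  case empty
  then show ?case by (auto simp: shattered_sets_def strongly_shattered_sets_def)
next
  case (insert e A)
  have "A \<in> strongly_shattered_sets (cofibre F {e})"
    using insert ample_cofibre_singleton[OF assms(1) insert.prems(1,2), of e]
      cofibre_subset[of F "{e}"]
    by (intro insert.IH) auto
  moreover have "cofibre (cofibre F {e}) A = cofibre F (insert e A)"
    using insert.hyps by (simp add: cofibre_cofibre)
  ultimately show ?case by (simp add: strongly_shattered_sets_def)
qed

text \<open>Shattered sets being strongly shattered, equality in the upper bound gives equality in
  the lower one, as \<open>flip_towards\<close> requires.\<close>

lemma ample_imp_card_strongly_shattered_sets:
  assumes "finite E" "F \<subseteq> Pow E" "card F = card (shattered_sets F)"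
  shows "card (strongly_shattered_sets F) = card F"
proof -
  have "shattered_sets F \<subseteq> strongly_shattered_sets F"
    using ample_shattered_imp_strongly_shattered[OF assms(1) _ assms(2,3)]
      shattered_sets_subset[OF assms(2)] assms(1) by (auto intro: finite_subset)
  then have "card (shattered_sets F) \<le> card (strongly_shattered_sets F)"
    using strongly_shattered_subset[OF assms(2)] assms(1)
    by (intro card_mono) (auto intro: finite_subset)
  then show ?thesis
    using card_strongly_shattered_sets_le_card[OF assms(1,2)] assms(3) by linarith
qed

text \<open>The inclusion joins the two ends of the sandwich, so all three numbers coincide.\<close>

lemma ample_if_shattered_imp_strongly_shattered:
  assumes "finite E" "F \<subseteq> Pow E" "shattered_sets F \<subseteq> strongly_shattered_sets F"
  shows "card F = card (shattered_sets F)"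
proof -
  have "card (shattered_sets F) \<le> card (strongly_shattered_sets F)"
    using strongly_shattered_subset[OF assms(2)] assms(1,3)
    by (intro card_mono) (auto intro: finite_subset)
  then show ?thesis
    using card_strongly_shattered_sets_le_card[OF assms(1,2)]
      card_le_card_shattered_sets[OF assms(1,2)] by linarith
qed

subsection \<open>Crossing a hyperplane in a weakly convex set\<close>

lemma abs_diff_le_l1_dist:
  assumes "finite E" "e \<in> E"
  shows "\<bar>x e - y e\<bar> \<le> l1_dist E x y"
  unfolding l1_dist_def using assms by (intro member_le_sum) auto

lemma l1_dist_nonneg: "0 \<le> l1_dist E x y"
  by (simp add: l1_dist_def sum_nonneg)

lemma l1_dist_tendsto:
  assumes "\<And>e. e \<in> E \<Longrightarrow> (\<lambda>n. f n e) \<longlonglongrightarrow> k e" "\<And>e. e \<in> E \<Longrightarrow> (\<lambda>n. g n e) \<longlonglongrightarrow> l e"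
  shows "(\<lambda>n. l1_dist E (f n) (g n)) \<longlonglongrightarrow> l1_dist E k l"
  unfolding l1_dist_def using assms by (intro tendsto_intros)

lemma real_vectors_eqI:
  assumes "x \<in> real_vectors E" "y \<in> real_vectors E" "\<And>e. e \<in> E \<Longrightarrow> x e = y e"
  shows "x = y"
  using assms unfolding real_vectors_def by (intro PiE_ext)

text \<open>The defects of the coordinatewise triangle inequalities are nonnegative and sum to the
  total defect, so metric betweenness is betweenness in every coordinate.\<close>

lemma l1_dist_add_iff:
  assumes "finite E"
  shows "l1_dist E x y = l1_dist E x z + l1_dist E z y \<longleftrightarrow>
           (\<forall>e\<in>E. \<bar>x e - y e\<bar> = \<bar>x e - z e\<bar> + \<bar>z e - y e\<bar>)"
proof -
  have "l1_dist E x z + l1_dist E z y - l1_dist E x y =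
      (\<Sum>e\<in>E. \<bar>x e - z e\<bar> + \<bar>z e - y e\<bar> - \<bar>x e - y e\<bar>)"
    unfolding l1_dist_def by (simp add: sum.distrib sum_subtractf)
  moreover have "\<dots> = 0 \<longleftrightarrow> (\<forall>e\<in>E. \<bar>x e - z e\<bar> + \<bar>z e - y e\<bar> - \<bar>x e - y e\<bar> = 0)"
    using assms by (intro sum_nonneg_eq_0_iff) auto
  ultimately show ?thesis by (smt (verit))
qed

text \<open>In a chain \<open>x\<close>, \<open>u\<close>, \<open>v\<close>, \<open>y\<close>, a
  point \<open>w\<close> between \<open>u\<close> and \<open>v\<close> may replace either of them.
  This is what shortens a pair straddling a hyperplane.\<close>

lemma abs_diff_between_refine:
  fixes u v w x y :: real
  assumes "\<bar>x - y\<bar> = \<bar>x - u\<bar> + \<bar>u - v\<bar> + \<bar>v - y\<bar>" "\<bar>u - v\<bar> = \<bar>u - w\<bar> + \<bar>w - v\<bar>"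
  shows "\<bar>x - y\<bar> = \<bar>x - w\<bar> + \<bar>w - v\<bar> + \<bar>v - y\<bar>" "\<bar>x - y\<bar> = \<bar>x - u\<bar> + \<bar>u - w\<bar> + \<bar>w - y\<bar>"
proof -
  \<comment> \<open>With the absolute value hidden, the claims are linear consequences of a few
    triangle inequalities.\<close>
  define d where "d a b = \<bar>a - b\<bar>" for a b :: real
  have tri: "d a c \<le> d a b + d b c" for a b c unfolding d_def by linarith
  note * = assms[folded d_def] tri[of x w u] tri[of x y w] tri[of w y v] tri[of u y w] tri[of x y u]
  show "\<bar>x - y\<bar> = \<bar>x - w\<bar> + \<bar>w - v\<bar> + \<bar>v - y\<bar>" unfolding d_def[symmetric] using * by linarith
  show "\<bar>x - y\<bar> = \<bar>x - u\<bar> + \<bar>u - w\<bar> + \<bar>w - y\<bar>" unfolding d_def[symmetric] using * by linarith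
qed

text \<open>Bolzano-Weierstrass by coordinates: a further subsequence settles the new coordinate and
  keeps the limits already obtained.\<close>

lemma bounded_convergent_subsequence:
  fixes f :: "nat \<Rightarrow> 'e \<Rightarrow> real"
  assumes "finite E" "\<And>e n. e \<in> E \<Longrightarrow> \<bar>f n e\<bar> \<le> b e"
  obtains r l where "strict_mono r" "l \<in> real_vectors E"
    "\<And>e. e \<in> E \<Longrightarrow> (\<lambda>n. f (r n) e) \<longlonglongrightarrow> l e"
proof -
  have "\<exists>r l. strict_mono (r :: nat \<Rightarrow> nat) \<and> (\<forall>e\<in>E. (\<lambda>n. f (r n) e) \<longlonglongrightarrow> (l e :: real))"
    using assms
  proof (induction E rule: finite_induct)
    case empty
    have "strict_mono (id :: nat \<Rightarrow> nat)" by (simp add: strict_mono_def)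
    then show ?case by blast
  next
    case (insert e E)
    obtain r l where r: "strict_mono r" "\<And>e. e \<in> E \<Longrightarrow> (\<lambda>n. f (r n) e) \<longlonglongrightarrow> l e"
      using insert by blast
    have "\<And>n. f (r n) e \<in> {- b e..b e}" using insert.prems by (auto simp: abs_le_iff minus_le_iff)
    then obtain c s where s: "strict_mono s" "((\<lambda>n. f (r n) e) \<circ> s) \<longlonglongrightarrow> c"
      using compact_Icc[of "- b e" "b e"] unfolding compact_def by metis
    have "(\<lambda>n. f ((r \<circ> s) n) e') \<longlonglongrightarrow> (l(e := c)) e'" if "e' \<in> insert e E" for e'
    proof (cases "e' = e")
      case True
      then show ?thesis using s(2) by (simp add: o_def)
    next
      case False
      then show ?thesis using that LIMSEQ_subseq_LIMSEQ[OF r(2) s(1), of e'] by (simp add: o_def)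
    qed
    then show ?case using strict_mono_o[OF r(1) s(1)] by blast
  qed
  then obtain r :: "nat \<Rightarrow> nat" and l :: "'e \<Rightarrow> real"
    where "strict_mono r" "\<And>e. e \<in> E \<Longrightarrow> (\<lambda>n. f (r n) e) \<longlonglongrightarrow> l e" by blast
  \<comment> \<open>\<open>restrict\<close> makes the limit \<open>undefined\<close> off
    \<open>E\<close>, as \<open>real_vectors\<close> demands.\<close>
  then show thesis using that[of r "restrict l E"] by (simp add: real_vectors_def)
qed

text \<open>With finitely many coordinates, pointwise convergence is metric convergence in the
  ambient space, so the sequence is Cauchy in \<open>K\<close>. Its limit in \<open>K\<close> has
  the same coordinates as \<open>l\<close>.\<close>

lemma mcomplete_pointwise_closed:
  assumes E: "finite E" and K: "K \<subseteq> real_vectors E" "Metric_space.mcomplete K (l1_dist E)"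
    and f: "\<And>n. f n \<in> K" "\<And>e. e \<in> E \<Longrightarrow> (\<lambda>n. f n e) \<longlonglongrightarrow> l e" and l: "l \<in> real_vectors E"
  shows "l \<in> K"
proof -
  interpret Metric_space K "l1_dist E" using Metric_space_l1_dist[OF E K(1)] .
  interpret R: Metric_space "real_vectors E" "l1_dist E"
    by (rule Metric_space_l1_dist[OF E order_refl])
  have fR: "f n \<in> real_vectors E" for n using f(1) K(1) by auto
  have "(\<lambda>n. l1_dist E (f n) l) \<longlonglongrightarrow> l1_dist E l l"
    by (rule l1_dist_tendsto) (simp_all add: f(2))
  then have "limitin R.mtopology f l sequentially"
    using fR l by (simp add: R.limitin_metric_dist_null)
  then have "R.MCauchy f"
    using fR by (intro R.convergent_imp_MCauchy) auto
  then have "MCauchy f"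
    using f(1) unfolding MCauchy_def R.MCauchy_def by auto
  then obtain k where k: "limitin mtopology f k sequentially"
    using K(2) unfolding mcomplete_def by auto
  have "l e = k e" if e: "e \<in> E" for e
  proof -
    have "(\<lambda>n. l1_dist E (f n) k) \<longlonglongrightarrow> 0"
      using k unfolding limitin_metric_dist_null by simp
    then have "(\<lambda>n. f n e - k e) \<longlonglongrightarrow> 0"
      by (rule Lim_null_comparison[rotated]) (simp add: abs_diff_le_l1_dist[OF E e])
    then have "(\<lambda>n. f n e) \<longlonglongrightarrow> k e" by (rule LIM_zero_cancel)
    with f(2)[OF e] show ?thesis by (rule LIMSEQ_unique)
  qed
  moreover have "k \<in> K" using k by (rule limitin_mspace)
  then have "k \<in> real_vectors E" using K(1) by blast
  ultimately have "l = k" using l by (intro real_vectors_eqI[of _ E])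
  then show ?thesis using \<open>k \<in> K\<close> by simp
qed

text \<open>A pair of points \<open>u\<close>, \<open>v\<close> on a geodesic from \<open>x\<close> to \<open>y\<close>, on either side of the hyperplane
  and at minimal distance, must coincide.\<close>

lemma weakly_convex_crossing:
  assumes E: "finite E" and wc: "weakly_convex E K"
    and xy: "x \<in> K" "y \<in> K" and e: "e \<in> E" "x e \<le> 0" "0 \<le> y e"
  obtains z where "z \<in> K" "z e = 0" "\<And>g. g \<in> E \<Longrightarrow> \<bar>x g - y g\<bar> = \<bar>x g - z g\<bar> + \<bar>z g - y g\<bar>"
proof -
  have K: "K \<subseteq> real_vectors E" "Metric_space.mcomplete K (l1_dist E)"
    using wc unfolding weakly_convex_def by auto
  interpret Metric_space K "l1_dist E" using Metric_space_l1_dist[OF E K(1)] .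
  \<comment> \<open>These are the pairs for which \<open>x\<close>, \<open>u\<close>,
    \<open>v\<close>, \<open>y\<close> is a geodesic chain with \<open>u\<close> and
    \<open>v\<close> on opposite closed sides of the hyperplane.\<close>
  define Q where "Q = {(u, v). u \<in> K \<and> v \<in> K \<and> u e \<le> 0 \<and> 0 \<le> v e \<and>
    (\<forall>g\<in>E. \<bar>x g - y g\<bar> = \<bar>x g - u g\<bar> + \<bar>u g - v g\<bar> + \<bar>v g - y g\<bar>)}"
  let ?d = "\<lambda>p. l1_dist E (fst p) (snd p)"
  define \<delta> where "\<delta> = Inf (?d ` Q)"
  have bdd: "bdd_below (?d ` Q)"
    by (rule bdd_belowI[of _ 0]) (auto simp: l1_dist_nonneg)
  have "(x, y) \<in> Q" using xy e unfolding Q_def by auto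
  then have ne: "?d ` Q \<noteq> {}" by auto
  have "\<exists>p\<in>Q. ?d p < \<delta> + inverse (Suc n)" for n
    using cInf_lessD[OF ne, of "\<delta> + inverse (Suc n)"] unfolding \<delta>_def by auto
  then obtain p where p: "\<And>n. p n \<in> Q" "\<And>n. ?d (p n) < \<delta> + inverse (Suc n)" by metis
  \<comment> \<open>In each coordinate, a point of such a chain is no farther from \<open>x\<close>
    than \<open>y\<close> is; this bounds both sequences.\<close>
  define b where "b g = \<bar>x g\<bar> + \<bar>x g - y g\<bar>" for g
  have bnd: "\<bar>fst q g\<bar> \<le> b g" "\<bar>snd q g\<bar> \<le> b g" if "q \<in> Q" "g \<in> E" for q g
  proof -
    have "\<bar>x g - y g\<bar> = \<bar>x g - fst q g\<bar> + \<bar>fst q g - snd q g\<bar> + \<bar>snd q g - y g\<bar>"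
      using that unfolding Q_def by auto
    then show "\<bar>fst q g\<bar> \<le> b g" "\<bar>snd q g\<bar> \<le> b g" unfolding b_def by linarith+
  qed
  obtain r u where r: "strict_mono r" and u: "u \<in> real_vectors E"
    and ru: "\<And>g. g \<in> E \<Longrightarrow> (\<lambda>n. fst (p (r n)) g) \<longlonglongrightarrow> u g"
    using bounded_convergent_subsequence[OF E, of "\<lambda>n. fst (p n)" b] bnd(1) p(1) by blast
  \<comment> \<open>The second extraction runs along the first subsequence, so both components
    converge along \<open>q\<close>.\<close>
  obtain s v where s: "strict_mono s" and v: "v \<in> real_vectors E"
    and sv: "\<And>g. g \<in> E \<Longrightarrow> (\<lambda>n. snd (p (r (s n))) g) \<longlonglongrightarrow> v g"
    using bounded_convergent_subsequence[OF E, of "\<lambda>n. snd (p (r n))" b] bnd(2) p(1) by blast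
  define q where "q n = p (r (s n))" for n
  have q: "q n \<in> Q" for n using p(1) unfolding q_def .
  have qu: "(\<lambda>n. fst (q n) g) \<longlonglongrightarrow> u g" if "g \<in> E" for g
    using LIMSEQ_subseq_LIMSEQ[OF ru[OF that] s] by (simp add: o_def q_def)
  have qv: "(\<lambda>n. snd (q n) g) \<longlonglongrightarrow> v g" if "g \<in> E" for g
    using sv[OF that] by (simp add: q_def)
  have "u \<in> K"
    using q by (intro mcomplete_pointwise_closed[OF E K _ qu u]) (auto simp: Q_def case_prod_beta)
  moreover have "v \<in> K"
    using q by (intro mcomplete_pointwise_closed[OF E K _ qv v]) (auto simp: Q_def case_prod_beta)
  moreover have "u e \<le> 0"
    using q by (intro LIMSEQ_le_const2[OF qu[OF e(1)]]) (auto simp: Q_def case_prod_beta)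
  moreover have "0 \<le> v e"
    using q by (intro LIMSEQ_le_const[OF qv[OF e(1)]]) (auto simp: Q_def case_prod_beta)
  moreover have "\<bar>x g - y g\<bar> = \<bar>x g - u g\<bar> + \<bar>u g - v g\<bar> + \<bar>v g - y g\<bar>" if g: "g \<in> E" for g
  proof -
    have "(\<lambda>n. \<bar>x g - fst (q n) g\<bar> + \<bar>fst (q n) g - snd (q n) g\<bar> + \<bar>snd (q n) g - y g\<bar>)
        \<longlonglongrightarrow> \<bar>x g - u g\<bar> + \<bar>u g - v g\<bar> + \<bar>v g - y g\<bar>"
      using qu[OF g] qv[OF g] by (intro tendsto_intros)
    moreover have "\<bar>x g - fst (q n) g\<bar> + \<bar>fst (q n) g - snd (q n) g\<bar> + \<bar>snd (q n) g - y g\<bar> = \<bar>x g - y g\<bar>" for n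
      using q[of n] g by (auto simp: Q_def case_prod_beta)
    ultimately show ?thesis by (simp add: LIMSEQ_const_iff)
  qed
  ultimately have uv: "(u, v) \<in> Q" unfolding Q_def by auto
  \<comment> \<open>The limit pair is in \<open>Q\<close>, so it attains the infimum.\<close>
  have "l1_dist E u v \<le> \<delta>"
  proof (rule LIMSEQ_le)
    show "(\<lambda>n. ?d (q n)) \<longlonglongrightarrow> l1_dist E u v" using qu qv by (rule l1_dist_tendsto)
    have "(\<lambda>n. \<delta> + inverse (real (Suc n))) \<longlonglongrightarrow> \<delta> + 0"
      by (intro tendsto_intros LIMSEQ_inverse_real_of_nat)
    from LIMSEQ_subseq_LIMSEQ[OF this strict_mono_o[OF r s]]
    show "(\<lambda>n. \<delta> + inverse (real (Suc (r (s n))))) \<longlonglongrightarrow> \<delta>" by (simp add: o_def)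
    show "\<exists>N. \<forall>n\<ge>N. ?d (q n) \<le> \<delta> + inverse (real (Suc (r (s n))))"
      using p(2) unfolding q_def by (meson less_imp_le)
  qed
  also have "\<delta> \<le> ?d t" if "t \<in> Q" for t
    unfolding \<delta>_def using bdd that by (intro cInf_lower) auto
  finally have min: "l1_dist E u v \<le> ?d t" if "t \<in> Q" for t using that .
  have "u = v"
  proof (rule ccontr)
    assume "u \<noteq> v"
    moreover have uvK: "u \<in> K" "v \<in> K" using uv unfolding Q_def by auto
    ultimately obtain w where w: "w \<in> K" "w \<noteq> u" "w \<noteq> v"
      and d: "l1_dist E u v = l1_dist E u w + l1_dist E w v"
      using wc unfolding weakly_convex_def by metis
    have pos: "0 < l1_dist E u w" "0 < l1_dist E w v"
      using w uvK mdist_pos_less by metis+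
    have bet: "\<bar>u g - v g\<bar> = \<bar>u g - w g\<bar> + \<bar>w g - v g\<bar>" if "g \<in> E" for g
      using d that unfolding l1_dist_add_iff[OF E] by auto
    have abs: "\<bar>x g - y g\<bar> = \<bar>x g - u g\<bar> + \<bar>u g - v g\<bar> + \<bar>v g - y g\<bar>" if "g \<in> E" for g
      using uv that unfolding Q_def by auto
    \<comment> \<open>\<open>w\<close> replaces the endpoint on its own side; the new pair is in
      \<open>Q\<close> and strictly closer.\<close>
    show False
    proof (cases "w e \<le> 0")
      case True
      have "\<bar>x g - y g\<bar> = \<bar>x g - w g\<bar> + \<bar>w g - v g\<bar> + \<bar>v g - y g\<bar>" if "g \<in> E" for g
        by (rule abs_diff_between_refine(1)[OF abs[OF that] bet[OF that]])
      then have "(w, v) \<in> Q" using uv w(1) True unfolding Q_def by auto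
      then show False using min[of "(w, v)"] d pos by auto
    next
      case False
      have "\<bar>x g - y g\<bar> = \<bar>x g - u g\<bar> + \<bar>u g - w g\<bar> + \<bar>w g - y g\<bar>" if "g \<in> E" for g
        by (rule abs_diff_between_refine(2)[OF abs[OF that] bet[OF that]])
      then have "(u, w) \<in> Q" using uv w(1) False unfolding Q_def by auto
      then show False using min[of "(u, w)"] d pos by auto
    qed
  qed
  then show thesis using uv that[of u] unfolding Q_def by auto
qed

subsection \<open>Orthant patterns and cubical complexes\<close>

definition sign_vector :: "'e set \<Rightarrow> 'e set \<Rightarrow> 'e \<Rightarrow> real" where
  "sign_vector E S = (\<lambda>e\<in>E. if e \<in> S then 1 else - 1)"

definition positive_parts :: "'e set \<Rightarrow> ('e \<Rightarrow> real) set \<Rightarrow> 'e set set" where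
  "positive_parts E L = {S. S \<subseteq> E \<and> sign_vector E S \<in> L}"

lemma positive_parts_subset: "positive_parts E L \<subseteq> Pow E"
  unfolding positive_parts_def by auto

lemma inj_on_sign_vector: "inj_on (sign_vector E) (Pow E)"
proof (rule inj_onI)
  fix S T assume "S \<in> Pow E" "T \<in> Pow E" "sign_vector E S = sign_vector E T"
  moreover from this have "e \<in> S \<longleftrightarrow> e \<in> T" if "e \<in> E" for e
    using that unfolding sign_vector_def by (auto dest!: fun_cong[of _ _ e] split: if_splits)
  ultimately show "S = T" by auto
qed

lemma sign_vectors_eq_image: "sign_vectors E = sign_vector E ` Pow E"
proof (intro equalityI subsetI)
  fix s assume s: "s \<in> sign_vectors E"
  have "s = sign_vector E {e \<in> E. s e = 1}"
    using s unfolding sign_vectors_def sign_vector_def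
    by (intro PiE_ext[of _ E "\<lambda>_. {-1, 1}"]) auto
  then show "s \<in> sign_vector E ` Pow E" by blast
qed (auto simp: sign_vectors_def sign_vector_def split: if_splits)

lemma sign_vector_image_positive_parts:
  assumes "L \<subseteq> sign_vectors E"
  shows "sign_vector E ` positive_parts E L = L"
  using assms unfolding positive_parts_def sign_vectors_eq_image by auto

text \<open>Restriction to \<open>A\<close> corresponds to intersection with \<open>A\<close>, and
  \<open>sign_vector A\<close> is injective on subsets of \<open>A\<close>.\<close>

lemma shattered_iff:
  assumes "L \<subseteq> sign_vectors E" "A \<subseteq> E"
  shows "shattered L A \<longleftrightarrow> A \<in> shattered_sets (positive_parts E L)"
proof -
  have *: "restrict (sign_vector E S) A = sign_vector A (A \<inter> S)" for S
    using assms(2) unfolding sign_vector_def by (intro ext) auto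
  have "(\<lambda>s. restrict s A) ` sign_vector E ` positive_parts E L =
      sign_vector A ` (\<inter>) A ` positive_parts E L"
    by (simp add: image_image *)
  then have "(\<lambda>s. restrict s A) ` L = sign_vector A ` (\<inter>) A ` positive_parts E L"
    unfolding sign_vector_image_positive_parts[OF assms(1)] .
  then have "shattered L A \<longleftrightarrow> (\<inter>) A ` positive_parts E L = Pow A"
    unfolding shattered_def sign_vectors_eq_image
    by (simp add: inj_on_image_eq_iff[OF inj_on_sign_vector] image_subset_iff)
  moreover have "(\<inter>) A ` positive_parts E L \<subseteq> Pow A" by auto
  ultimately have "shattered L A \<longleftrightarrow> Pow A \<subseteq> (\<inter>) A ` positive_parts E L"
    by (simp only: set_eq_subset simp_thms)
  then show ?thesis unfolding shattered_sets_def by simp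
qed

lemma ample_iff:
  assumes "L \<subseteq> sign_vectors E"
  shows "ample E L \<longleftrightarrow> card (positive_parts E L) = card (shattered_sets (positive_parts E L))"
proof -
  have "inj_on (sign_vector E) (positive_parts E L)"
    using inj_on_sign_vector positive_parts_subset by (rule inj_on_subset)
  from card_image[OF this] have "card L = card (positive_parts E L)"
    unfolding sign_vector_image_positive_parts[OF assms] .
  moreover have "A \<subseteq> E \<and> shattered L A \<longleftrightarrow> A \<in> shattered_sets (positive_parts E L)" for A
    using shattered_iff[OF assms, of A] shattered_sets_subset[OF positive_parts_subset, of E L] by auto
  then have "{A. A \<subseteq> E \<and> shattered L A} = shattered_sets (positive_parts E L)" by simp
  ultimately show ?thesis unfolding ample_def by simp
qed

section \<open>From weak convexity to ampleness\<close>

text \<open>Coordinates of \<open>A\<close> are made zero one by one. The induction keeps a point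
  for every sign pattern \<open>C\<close> on \<open>A\<close>, because the next crossing needs two
  points with opposite signs at the new coordinate.\<close>

lemma weakly_convex_shattered_zero:
  assumes E: "finite E" and wc: "weakly_convex E K"
    and A: "A \<in> shattered_sets (positive_parts E (orthant_pattern E K))"
  obtains z where "z \<in> K" "\<And>e. e \<in> A \<Longrightarrow> z e = 0"
proof -
  have AE: "A \<subseteq> E" using shattered_sets_subset[OF positive_parts_subset] A by auto
  have *: "\<exists>z\<in>K. (\<forall>e\<in>B. z e = 0) \<and> (\<forall>e\<in>A. 0 \<le> z e * sign_vector E C e)"
    if "finite B" "B \<subseteq> A" "C \<subseteq> A" for B C
    using that
  proof (induction B arbitrary: C rule: finite_induct)
    case empty
    obtain S where S: "S \<in> positive_parts E (orthant_pattern E K)" "A \<inter> S = C"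
      using shattered_setsE[OF A] empty by metis
    then obtain z where z: "z \<in> K" "\<And>e. e \<in> E \<Longrightarrow> 0 \<le> z e * sign_vector E S e"
      unfolding positive_parts_def orthant_pattern_def orthant_def by blast
    have "sign_vector E S e = sign_vector E C e" if "e \<in> A" for e
      using that AE S(2) unfolding sign_vector_def by auto
    then have "\<forall>e\<in>A. 0 \<le> z e * sign_vector E C e" using z(2) AE by (metis subsetD)
    then show ?case using z(1) by blast
  next
    case (insert e B)
    have e: "e \<in> A" "e \<in> E" using insert.prems AE by auto
    \<comment> \<open>The patterns \<open>C - {e}\<close> and \<open>insert e C\<close> differ only
      at \<open>e\<close>, so the points \<open>x\<close> and \<open>y\<close> lie on opposite sides
      there.\<close>
    obtain x where x: "x \<in> K" "\<And>g. g \<in> B \<Longrightarrow> x g = 0"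
        "\<And>g. g \<in> A \<Longrightarrow> 0 \<le> x g * sign_vector E (C - {e}) g"
      using insert.IH[of "C - {e}"] insert.prems by blast
    obtain y where y: "y \<in> K" "\<And>g. g \<in> B \<Longrightarrow> y g = 0"
        "\<And>g. g \<in> A \<Longrightarrow> 0 \<le> y g * sign_vector E (insert e C) g"
      using insert.IH[of "insert e C"] insert.prems by blast
    have "x e \<le> 0" "0 \<le> y e"
      using x(3)[OF e(1)] y(3)[OF e(1)] e(2) unfolding sign_vector_def by auto
    then obtain z where z: "z \<in> K" "z e = 0"
        "\<And>g. g \<in> E \<Longrightarrow> \<bar>x g - y g\<bar> = \<bar>x g - z g\<bar> + \<bar>z g - y g\<bar>"
      using weakly_convex_crossing[OF E wc x(1) y(1) e(2)] by metis
    \<comment> \<open>A value between two zeros is zero, and a value between two of one sign keeps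
      that sign, so crossing at \<open>e\<close> spoils nothing gained before.\<close>
    have "z g = 0" if "g \<in> insert e B" for g
    proof (cases "g = e")
      case False
      then have "g \<in> B" using that by simp
      then show ?thesis using x(2)[of g] y(2)[of g] z(3)[of g] insert.prems AE by auto
    qed (simp add: z(2))
    moreover have "0 \<le> z g * sign_vector E C g" if g: "g \<in> A" for g
    proof (cases "g = e")
      case False
      then have "sign_vector E (C - {e}) g = sign_vector E C g"
        "sign_vector E (insert e C) g = sign_vector E C g"
        unfolding sign_vector_def by auto
      moreover have "sign_vector E C g = 1 \<or> sign_vector E C g = - 1"
        using g AE unfolding sign_vector_def by auto
      ultimately show ?thesis using x(3)[OF g] y(3)[OF g] z(3)[of g] g AE by auto
    qed (simp add: z(2))
    ultimately show ?case using z(1) by blast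
  qed
  have "finite A" using E AE by (rule finite_subset[rotated])
  then show thesis using *[of A "{}"] that by blast
qed

text \<open>A point vanishing on \<open>A\<close> stays in its orthant under any change of signs on
  \<open>A\<close>, so these orthants give a cube with direction set \<open>A\<close>.\<close>

lemma weakly_convex_imp_ample:
  assumes E: "finite E" and wc: "weakly_convex E K"
  shows "ample E (orthant_pattern E K)"
proof -
  let ?F = "positive_parts E (orthant_pattern E K)"
  have "A \<in> strongly_shattered_sets ?F" if A: "A \<in> shattered_sets ?F" for A
  proof -
    obtain z where z: "z \<in> K" "\<And>e. e \<in> A \<Longrightarrow> z e = 0"
      using weakly_convex_shattered_zero[OF E wc A] by metis
    have AE: "A \<subseteq> E" using shattered_sets_subset[OF positive_parts_subset] A by auto
    \<comment> \<open>Zero coordinates count as negative, which makes \<open>S\<close> disjoint from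
      \<open>A\<close> and hence a bottom vertex.\<close>
    define S where "S = {e \<in> E. 0 < z e}"
    have "S \<union> C \<in> ?F" if C: "C \<subseteq> A" for C
    proof -
      have SC: "S \<union> C \<subseteq> E" using C AE unfolding S_def by auto
      then have "sign_vector E (S \<union> C) \<in> sign_vectors E"
        unfolding sign_vectors_eq_image by blast
      moreover have "0 \<le> z e * sign_vector E (S \<union> C) e" if "e \<in> E" for e
        using that z(2) C unfolding S_def sign_vector_def by (cases "e \<in> A") auto
      then have "z \<in> K \<inter> orthant E (sign_vector E (S \<union> C))"
        using z(1) wc unfolding weakly_convex_def orthant_def by auto
      ultimately show ?thesis
        using SC unfolding positive_parts_def orthant_pattern_def by auto
    qed
    moreover have "S \<inter> A = {}" using z(2) unfolding S_def by auto
    ultimately have "S \<in> cofibre ?F A" unfolding cofibre_def by simp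
    then show ?thesis unfolding strongly_shattered_sets_def by auto
  qed
  then have "card ?F = card (shattered_sets ?F)"
    by (intro ample_if_shattered_imp_strongly_shattered[OF E positive_parts_subset] subsetI)
  then show ?thesis by (subst ample_iff) (auto simp: orthant_pattern_def)
qed

section \<open>The cubical complex of a family\<close>

text \<open>The union of those faces of the cube all of whose vertices belong to the family.\<close>

definition cubical_complex :: "'e set \<Rightarrow> 'e set set \<Rightarrow> ('e \<Rightarrow> real) set" where
  "cubical_complex E F =
     {r \<in> hypercube E. \<forall>T\<subseteq>E. {e \<in> E. r e = 1} \<subseteq> T \<longrightarrow> T \<subseteq> {e \<in> E. r e \<noteq> - 1} \<longrightarrow> T \<in> F}"

lemma hypercube_subset_real_vectors: "hypercube E \<subseteq> real_vectors E"
  unfolding hypercube_def real_vectors_def by auto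

text \<open>For a sign vector the interval of sets \<open>T\<close> in the definition shrinks to its
  positive part. Conversely, if an orthant meets the complex at \<open>r\<close>, its positive part
  is a vertex of the smallest face containing \<open>r\<close>.\<close>

lemma orthant_pattern_cubical_complex:
  assumes "L \<subseteq> sign_vectors E"
  shows "orthant_pattern E (cubical_complex E (positive_parts E L)) = L"
proof (intro equalityI subsetI)
  fix s assume "s \<in> L"
  then obtain S where S: "S \<in> positive_parts E L" "s = sign_vector E S"
    using sign_vector_image_positive_parts[OF assms] by auto
  have "S \<subseteq> E" using S(1) positive_parts_subset by auto
  have "T \<in> positive_parts E L"
    if "T \<subseteq> E" "{e \<in> E. s e = 1} \<subseteq> T" "T \<subseteq> {e \<in> E. s e \<noteq> - 1}" for T
  proof -
    have "T = S"
      using that \<open>S \<subseteq> E\<close> S(2) unfolding sign_vector_def by (auto split: if_splits)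
    then show ?thesis using S(1) by simp
  qed
  moreover have "s \<in> hypercube E"
    unfolding S(2) hypercube_def sign_vector_def by auto
  ultimately have "s \<in> cubical_complex E (positive_parts E L)"
    unfolding cubical_complex_def by blast
  moreover have "s \<in> orthant E s"
    using S(2) unfolding orthant_def real_vectors_def by (auto simp: sign_vector_def)
  ultimately show "s \<in> orthant_pattern E (cubical_complex E (positive_parts E L))"
    using \<open>s \<in> L\<close> assms unfolding orthant_pattern_def by auto
next
  fix s assume s: "s \<in> orthant_pattern E (cubical_complex E (positive_parts E L))"
  then obtain S where S: "S \<subseteq> E" "s = sign_vector E S"
    unfolding orthant_pattern_def sign_vectors_eq_image by auto
  from s obtain r where r: "r \<in> cubical_complex E (positive_parts E L)"
    "\<And>e. e \<in> E \<Longrightarrow> 0 \<le> r e * s e"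
    unfolding orthant_pattern_def orthant_def by auto
  have "{e \<in> E. r e = 1} \<subseteq> S"
  proof
    fix e assume "e \<in> {e \<in> E. r e = 1}"
    then show "e \<in> S"
      using r(2)[of e] unfolding S(2) sign_vector_def by (auto split: if_splits)
  qed
  moreover have "S \<subseteq> {e \<in> E. r e \<noteq> - 1}"
  proof
    fix e assume "e \<in> S"
    then show "e \<in> {e \<in> E. r e \<noteq> - 1}"
      using r(2)[of e] S(1) unfolding S(2) sign_vector_def by (auto split: if_splits)
  qed
  ultimately have "S \<in> positive_parts E L"
    using r(1) S(1) unfolding cubical_complex_def by simp
  then show "s \<in> L" using S(2) unfolding positive_parts_def by simp
qed

text \<open>The strict inequalities \<open>l e < 1\<close> and \<open>- 1 < l e\<close> pass to all
  late terms, so a vertex of the smallest face at \<open>l\<close> is one at \<open>f n\<close> for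
  large \<open>n\<close>.\<close>

lemma cubical_complex_pointwise_closed:
  assumes E: "finite E" and f: "\<And>n. f n \<in> cubical_complex E F"
    and lim: "\<And>e. e \<in> E \<Longrightarrow> (\<lambda>n. f n e) \<longlonglongrightarrow> l e" and l: "l \<in> real_vectors E"
  shows "l \<in> cubical_complex E F"
proof -
  have fb: "- 1 \<le> f n e" "f n e \<le> 1" if "e \<in> E" for n e
    using f[of n] that unfolding cubical_complex_def hypercube_def by (auto simp: PiE_iff)
  have lb: "- 1 \<le> l e" "l e \<le> 1" if "e \<in> E" for e
    using fb[OF that] by (auto intro: LIMSEQ_le_const[OF lim[OF that]] LIMSEQ_le_const2[OF lim[OF that]])
  then have "l \<in> hypercube E"
    using l lb unfolding hypercube_def real_vectors_def by (auto simp: PiE_iff)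
  moreover have "T \<in> F" if T: "T \<subseteq> E" "{e \<in> E. l e = 1} \<subseteq> T" "T \<subseteq> {e \<in> E. l e \<noteq> - 1}" for T
  proof -
    have "\<forall>\<^sub>F n in sequentially. (f n e = 1 \<longrightarrow> e \<in> T) \<and> (e \<in> T \<longrightarrow> f n e \<noteq> - 1)"
      if e: "e \<in> E" for e
    proof (cases "e \<in> T")
      case True
      then have "- 1 < l e" using T lb(1)[OF e] by (auto simp: less_le)
      then have "\<forall>\<^sub>F n in sequentially. - 1 < f n e" using lim[OF e] by (metis order_tendstoD(1))
      then show ?thesis by (rule eventually_mono) (use True in auto)
    next
      case False
      then have "l e < 1" using T e lb(2)[OF e] by (auto simp: less_le)
      then have "\<forall>\<^sub>F n in sequentially. f n e < 1" using lim[OF e] by (metis order_tendstoD(2))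
      then show ?thesis by (rule eventually_mono) (use False in auto)
    qed
    then have "\<forall>\<^sub>F n in sequentially. \<forall>e\<in>E. (f n e = 1 \<longrightarrow> e \<in> T) \<and> (e \<in> T \<longrightarrow> f n e \<noteq> - 1)"
      using E by (simp add: eventually_ball_finite_distrib)
    then obtain n where "\<And>e. e \<in> E \<Longrightarrow> (f n e = 1 \<longrightarrow> e \<in> T) \<and> (e \<in> T \<longrightarrow> f n e \<noteq> - 1)"
      unfolding eventually_sequentially by blast
    then have "{e \<in> E. f n e = 1} \<subseteq> T" "T \<subseteq> {e \<in> E. f n e \<noteq> - 1}" using T(1) by auto
    then show ?thesis using f[of n] T(1) unfolding cubical_complex_def by blast
  qed
  ultimately show ?thesis unfolding cubical_complex_def by blast
qed

lemma l1_compact_cubical_complex: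
  assumes E: "finite E"
  shows "l1_compact E (cubical_complex E F)"
proof -
  interpret Metric_space "real_vectors E" "l1_dist E"
    by (rule Metric_space_l1_dist[OF E order_refl])
  have sub: "cubical_complex E F \<subseteq> real_vectors E"
    using hypercube_subset_real_vectors unfolding cubical_complex_def by auto
  have "\<exists>l r. l \<in> cubical_complex E F \<and> strict_mono r \<and> limitin mtopology (f \<circ> r) l sequentially"
    if "range f \<subseteq> cubical_complex E F" for f :: "nat \<Rightarrow> _"
  proof -
    have f: "f n \<in> cubical_complex E F" for n using that by auto
    have "\<bar>f n e\<bar> \<le> 1" if "e \<in> E" for e n
      using f[of n] that unfolding cubical_complex_def hypercube_def
      by (auto simp: PiE_iff abs_le_iff minus_le_iff)
    then obtain r l where r: "strict_mono r" "l \<in> real_vectors E"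
      "\<And>e. e \<in> E \<Longrightarrow> (\<lambda>n. f (r n) e) \<longlonglongrightarrow> l e"
      using bounded_convergent_subsequence[OF E, of f "\<lambda>_. 1"] by metis
    have "l \<in> cubical_complex E F"
      using cubical_complex_pointwise_closed[OF E f r(3,2)] .
    moreover have "(\<lambda>n. l1_dist E (f (r n)) l) \<longlonglongrightarrow> l1_dist E l l"
      by (rule l1_dist_tendsto) (simp_all add: r(3))
    then have "limitin mtopology (f \<circ> r) l sequentially"
      using f sub r(2) by (simp add: limitin_metric_dist_null o_def subset_eq)
    ultimately show ?thesis using r(1) by blast
  qed
  then show ?thesis unfolding l1_compact_def compactin_sequentially using sub by blast
qed

text \<open>Moving a coordinate inside the open interval does not change the smallest face.\<close>

lemma cubical_complex_update:
  assumes "x \<in> cubical_complex E F" "e \<in> E" "\<bar>x e\<bar> < 1" "\<bar>c\<bar> < 1"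
  shows "x(e := c) \<in> cubical_complex E F"
proof -
  have "{g \<in> E. (x(e := c)) g = 1} = {g \<in> E. x g = 1}"
    "{g \<in> E. (x(e := c)) g \<noteq> - 1} = {g \<in> E. x g \<noteq> - 1}"
    using assms by auto
  moreover have "x(e := c) \<in> hypercube E"
    using assms unfolding cubical_complex_def hypercube_def by (auto simp: PiE_iff extensional_def)
  ultimately show ?thesis using assms(1) unfolding cubical_complex_def by simp
qed

text \<open>The smallest face containing \<open>x\<close> has its non-integral coordinates as
  directions, and this set is its bottom vertex.\<close>

lemma cubical_complex_vertex:
  assumes "x \<in> cubical_complex E F"
  shows "{e \<in> E. x e = 1} \<in> cofibre F {e \<in> E. \<bar>x e\<bar> < 1}"
proof -
  have "{e \<in> E. x e = 1} \<union> C \<in> F" if "C \<subseteq> {e \<in> E. \<bar>x e\<bar> < 1}" for C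
  proof -
    have "{e \<in> E. x e = 1} \<union> C \<subseteq> {e \<in> E. x e \<noteq> - 1}" using that by auto
    then show ?thesis using assms unfolding cubical_complex_def by blast
  qed
  then show ?thesis unfolding cofibre_def by auto
qed

lemma strictly_between_abs_less_1:
  fixes a b :: real
  assumes "\<bar>a\<bar> < 1" "\<bar>b\<bar> \<le> 1" "a \<noteq> b"
  obtains c where "\<bar>c\<bar> < 1" "c \<noteq> a" "c \<noteq> b" "\<bar>a - b\<bar> = \<bar>a - c\<bar> + \<bar>c - b\<bar>"
proof (rule that[of "(a + b) / 2"])
  show "\<bar>(a + b) / 2\<bar> < 1" using assms(1,2) by (simp add: abs_less_iff abs_le_iff)
  show "(a + b) / 2 \<noteq> a" "(a + b) / 2 \<noteq> b" using assms by auto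
  show "\<bar>a - b\<bar> = \<bar>a - (a + b) / 2\<bar> + \<bar>(a + b) / 2 - b\<bar>" by (simp add: abs_if field_simps)
qed

lemma cubical_complex_between:
  assumes E: "finite E" and F: "F \<subseteq> Pow E" and am: "card F = card (shattered_sets F)"
    and x: "x \<in> cubical_complex E F" and y: "y \<in> cubical_complex E F" and "x \<noteq> y"
  obtains z where "z \<in> cubical_complex E F" "z \<noteq> x" "z \<noteq> y"
    "\<And>e. e \<in> E \<Longrightarrow> \<bar>x e - y e\<bar> = \<bar>x e - z e\<bar> + \<bar>z e - y e\<bar>"
proof -
  have bx: "\<bar>x e\<bar> \<le> 1" and b_y: "\<bar>y e\<bar> \<le> 1" if "e \<in> E" for e
    using x y that unfolding cubical_complex_def hypercube_def
    by (auto simp: PiE_iff abs_le_iff minus_le_iff)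
  \<comment> \<open>If the points differ at a coordinate non-integral for one of them, moving that
    coordinate stays in the face. Otherwise both have the same non-integral coordinates, with equal
    values.\<close>
  consider (x) e where "e \<in> E" "\<bar>x e\<bar> < 1" "x e \<noteq> y e"
    | (y) e where "e \<in> E" "\<bar>y e\<bar> < 1" "x e \<noteq> y e"
    | (xy) "\<And>e. e \<in> E \<Longrightarrow> \<bar>x e\<bar> < 1 \<or> \<bar>y e\<bar> < 1 \<Longrightarrow> x e = y e"
    by blast
  then show thesis
  proof cases
    case x
    obtain c where c: "\<bar>c\<bar> < 1" "c \<noteq> x e" "c \<noteq> y e"
      "\<bar>x e - y e\<bar> = \<bar>x e - c\<bar> + \<bar>c - y e\<bar>"
      using strictly_between_abs_less_1[OF x(2) b_y[OF x(1)]] x(3) by metis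
    have "x(e := c) \<in> cubical_complex E F"
      using \<open>x \<in> cubical_complex E F\<close> x(1,2) c(1) by (rule cubical_complex_update)
    moreover have "x(e := c) \<noteq> x" "x(e := c) \<noteq> y"
      using c(2,3) by (metis fun_upd_same)+
    moreover have "\<bar>x g - y g\<bar> = \<bar>x g - (x(e := c)) g\<bar> + \<bar>(x(e := c)) g - y g\<bar>" for g
      using c(4) by (simp add: abs_minus_commute add.commute)
    ultimately show thesis using that by blast
  next
    case y
    obtain c where c: "\<bar>c\<bar> < 1" "c \<noteq> y e" "c \<noteq> x e"
      "\<bar>y e - x e\<bar> = \<bar>y e - c\<bar> + \<bar>c - x e\<bar>"
      using strictly_between_abs_less_1[OF y(2) bx[OF y(1)]] y(3) by metis
    have "y(e := c) \<in> cubical_complex E F"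
      using \<open>y \<in> cubical_complex E F\<close> y(1,2) c(1) by (rule cubical_complex_update)
    moreover have "y(e := c) \<noteq> x" "y(e := c) \<noteq> y"
      using c(2,3) by (metis fun_upd_same)+
    moreover have "\<bar>x g - y g\<bar> = \<bar>x g - (y(e := c)) g\<bar> + \<bar>(y(e := c)) g - y g\<bar>" for g
      using c(4) by (simp add: abs_minus_commute add.commute)
    ultimately show thesis using that by blast
  next
    case xy
    define X where "X = {e \<in> E. \<bar>x e\<bar> < 1}"
    define S where "S = {e \<in> E. x e = 1}"
    define T where "T = {e \<in> E. y e = 1}"
    define M where "M = cofibre F X"
    have "\<bar>x e\<bar> < 1 \<longleftrightarrow> \<bar>y e\<bar> < 1" if "e \<in> E" for e using xy[OF that] by argo
    then have X': "X = {e \<in> E. \<bar>y e\<bar> < 1}" unfolding X_def by blast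
    have ST: "S \<in> M" "T \<in> M"
      using cubical_complex_vertex[OF x] cubical_complex_vertex[OF y]
      unfolding M_def S_def T_def X_def[symmetric] X'[symmetric] by simp_all
    have xS: "x e = (if e \<in> S then 1 else - 1)" if "e \<in> E - X" for e
      using that bx[of e] unfolding S_def X_def by (auto simp: abs_if split: if_splits)
    have yT: "y e = (if e \<in> T then 1 else - 1)" if "e \<in> E - X" for e
      using that b_y[of e] unfolding T_def X' by (auto simp: abs_if split: if_splits)
    have "S \<noteq> T"
    proof
      assume "S = T"
      have "x e = y e" if "e \<in> E" for e
      proof (cases "e \<in> X")
        case True
        then show ?thesis using xy[OF that] unfolding X_def by simp
      next
        case False
        then show ?thesis using xS[of e] yT[of e] that \<open>S = T\<close> by simp
      qed
      moreover have "x \<in> real_vectors E" "y \<in> real_vectors E"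
        using x y hypercube_subset_real_vectors unfolding cubical_complex_def by auto
      ultimately have "x = y" by (intro real_vectors_eqI[of _ E])
      then show False using \<open>x \<noteq> y\<close> by simp
    qed
    have M: "M \<subseteq> Pow E" using cofibre_subset F unfolding M_def by blast
    have "finite X" using E unfolding X_def by simp
    \<comment> \<open>The cofibre \<open>M\<close> is again ample, so \<open>S\<close> can be moved
      one step towards \<open>T\<close> to an adjacent \<open>X\<close>-cube of
      \<open>F\<close>.\<close>
    from ample_imp_card_strongly_shattered_sets[OF E M[unfolded M_def] ample_cofibre[OF E F am this]]
    have "card (strongly_shattered_sets M) = card M" unfolding M_def .
    from flip_towards[OF E M this ST \<open>S \<noteq> T\<close>]
    obtain e where e: "e \<in> sym_diff S T" "sym_diff S {e} \<in> M" by blast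
    have SX: "S \<inter> X = {}" "T \<inter> X = {}" using ST unfolding M_def cofibre_def by auto
    have SE: "S \<subseteq> E" "T \<subseteq> E" unfolding S_def T_def by auto
    have eE: "e \<in> E - X" using e(1) SX SE by auto
    then have xe: "x e = (if e \<in> S then 1 else - 1)" and ye: "y e = - x e"
      using xS yT e(1) by auto
    \<comment> \<open>At \<open>e\<close> the points have opposite values of modulus 1, so 0 lies
      strictly between them.\<close>
    let ?z = "x(e := 0)"
    \<comment> \<open>The face at \<open>?z\<close> joins the \<open>X\<close>-cubes at
      \<open>S\<close> and \<open>sym_diff S {e}\<close>; membership of \<open>e\<close> tells which
      of them has \<open>U\<close> as a vertex.\<close>
    have "U \<in> F" if U: "U \<subseteq> E" "{g \<in> E. ?z g = 1} \<subseteq> U" "U \<subseteq> {g \<in> E. ?z g \<noteq> - 1}" for U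
    proof (cases "e \<in> U \<longleftrightarrow> e \<in> S")
      case True
      have "g \<in> U" if "g \<in> E" "x g = 1" for g
        using U(2) True that xe by (cases "g = e") (auto split: if_splits)
      moreover have "x g \<noteq> - 1" if "g \<in> U" for g
        using U(3) True that xe by (cases "g = e") auto
      ultimately have "{g \<in> E. x g = 1} \<subseteq> U" "U \<subseteq> {g \<in> E. x g \<noteq> - 1}" using U(1) by auto
      then show ?thesis using x U(1) unfolding cubical_complex_def by blast
    next
      case False
      have "g \<in> U \<longleftrightarrow> g \<in> sym_diff S {e} \<union> (U \<inter> X)" for g
      proof -
        consider "g = e" | "g \<in> X" | "g \<notin> E" | "g \<noteq> e" "g \<in> E - X" by blast
        then show ?thesis
        proof cases
          case 1
          then show ?thesis using False eE by auto
        next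
          case 2
          then show ?thesis using SX eE by auto
        next
          case 3
          then show ?thesis using SE U(1) eE by auto
        next
          case 4
          then have "x g = 1 \<longleftrightarrow> g \<in> S" "x g = - 1 \<longleftrightarrow> g \<notin> S" using xS[of g] by auto
          moreover have "x g = 1 \<longrightarrow> g \<in> U" "g \<in> U \<longrightarrow> x g \<noteq> - 1" using U(2,3) 4 by auto
          ultimately show ?thesis using 4 by auto
        qed
      qed
      then have "U = sym_diff S {e} \<union> (U \<inter> X)" by blast
      moreover have "sym_diff S {e} \<union> (U \<inter> X) \<in> F"
        using e(2) unfolding M_def cofibre_def by blast
      ultimately show ?thesis by simp
    qed
    moreover have "?z \<in> hypercube E"
      using x eE unfolding cubical_complex_def hypercube_def by (auto simp: PiE_iff extensional_def)
    ultimately have "?z \<in> cubical_complex E F" unfolding cubical_complex_def by blast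
    moreover have "?z \<noteq> x" "?z \<noteq> y"
      using xe ye by (metis fun_upd_same zero_neq_one neg_equal_0_iff_equal)+
    moreover have "\<bar>x g - y g\<bar> = \<bar>x g - ?z g\<bar> + \<bar>?z g - y g\<bar>" for g
      using ye by (cases "g = e") auto
    ultimately show thesis using that by blast
  qed
qed

text \<open>Completeness comes from compactness, and betweenness from the coordinatewise
  construction.\<close>

lemma weakly_convex_cubical_complex:
  assumes E: "finite E" and F: "F \<subseteq> Pow E" and am: "card F = card (shattered_sets F)"
  shows "weakly_convex E (cubical_complex E F)"
proof -
  have sub: "cubical_complex E F \<subseteq> real_vectors E"
    using hypercube_subset_real_vectors unfolding cubical_complex_def by auto
  interpret Submetric "real_vectors E" "l1_dist E" "cubical_complex E F"
    using Metric_space_l1_dist[OF E order_refl] sub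
    by (simp add: Submetric_def Submetric_axioms_def)
  have "sub.mcomplete"
    using l1_compact_cubical_complex[OF E] unfolding l1_compact_def by (rule compactin_imp_mcomplete)
  moreover have "\<exists>z\<in>cubical_complex E F. z \<noteq> x \<and> z \<noteq> y \<and> l1_dist E x y = l1_dist E x z + l1_dist E z y"
    if "x \<in> cubical_complex E F" "y \<in> cubical_complex E F" "x \<noteq> y" for x y
    using cubical_complex_between[OF E F am that] unfolding l1_dist_add_iff[OF E] by metis
  ultimately show ?thesis using sub unfolding weakly_convex_def by blast
qed

theorem theorem4:
  fixes E :: "'e set" and L :: "('e \<Rightarrow> real) set"
  assumes "finite E"
    and "L \<subseteq> sign_vectors E"
  shows "(ample E L \<longleftrightarrow>
            (\<exists>K. weakly_convex E K \<and> L = orthant_pattern E K)) \<and>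
         (ample E L \<longleftrightarrow>
            (\<exists>K. K \<subseteq> hypercube E \<and> l1_compact E K \<and> weakly_convex E K \<and>
                 L = orthant_pattern E K))"
proof -
  \<comment> \<open>Since (c) contains (b), the implications from (a) to (c) and from (b) to (a)
    close the cycle.\<close>
  have "\<exists>K. K \<subseteq> hypercube E \<and> l1_compact E K \<and> weakly_convex E K \<and> L = orthant_pattern E K"
    if "ample E L"
  proof (intro exI conjI)
    let ?K = "cubical_complex E (positive_parts E L)"
    show "?K \<subseteq> hypercube E" unfolding cubical_complex_def by blast
    show "l1_compact E ?K" by (rule l1_compact_cubical_complex[OF assms(1)])
    show "weakly_convex E ?K"
      using that assms by (intro weakly_convex_cubical_complex positive_parts_subset) (simp_all add: ample_iff)
    show "L = orthant_pattern E ?K"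
      using orthant_pattern_cubical_complex[OF assms(2)] by simp
  qed
  moreover have "ample E L" if "weakly_convex E K" "L = orthant_pattern E K" for K
    using weakly_convex_imp_ample[OF assms(1) that(1)] that(2) by simp
  ultimately show ?thesis by blast
qed

end
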